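(* Let $\Gamma=(V,E)$ be an infinite weighted graph with $\bar h(\Gamma)\le 1-\epsilon_0$ for some $0<\epsilon_0<1$, and fix a vertex $x_0\in V$. If $$\limsup_{r\to\infty}\frac{Q_r}{\mathrm{vol}(B_r)}<\epsilon_0,$$ then there exist constants $C_1,C_2>0$ such that $\mathrm{vol}(B_r)\ge C_1e^{C_2r}$ for all integers $r\ge1$.
   Context: $\Gamma=(V,E)$ is a locally finite, connected graph with infinitely many vertices, equipped with symmetric edge weights $\mu_{xy}=\mu_{yx}\ge 0$, where $\mu_{xy}>0$ iff $(x,y)\in E$; self-loops ($\mu_{xx}>0$) are allowed. Put $\mu(x)=\sum_{y\in V}\mu_{xy}$, $\mathrm{vol}(U)=\sum_{x\in U}\mu(x)$ and $|E(V_1,V_2)|=\sum_{x\in V_1}\sum_{y\in V_2}\mu_{xy}$ for finite $U,V_1,V_2\subset V$. With $d$ the graph distance, $B_r=\{y:d(y,x_0)\le r\}$, $S_r=\{y\in V:d(y,x_0)=r\}$, $q_r=|E(S_r,S_r)|$ and $Q_r=\sum_{i=0}^rq_i$. The dual Cheeger constant is $\bar h(\Gamma)=\sup\left\{\frac{2|E(V_1,V_2)|}{\mathrm{vol}(V_1)+\mathrm{vol}(V_2)}\right\}$, the supremum over pairs of disjoint nonempty finite subsets $V_1,V_2\subset V$. *)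

theory Defs
  imports Complex_Main "HOL-Library.Extended_Real"
begin

text \<open>
  Edges are ordered pairs; symmetry of \<open>E\<close> follows from that of the weights.
  Self-loops \<open>(x, x) \<in> E\<close> are allowed. Values of \<open>\<mu>\<close> outside \<open>V \<times> V\<close> are never used.
\<close>

locale infinite_weighted_graph =
  fixes V :: "'a set" and E :: "('a \<times> 'a) set" and \<mu> :: "'a \<Rightarrow> 'a \<Rightarrow> real"
  assumes edges_subset: "E \<subseteq> V \<times> V"
    and weight_sym: "\<And>x y. x \<in> V \<Longrightarrow> y \<in> V \<Longrightarrow> \<mu> x y = \<mu> y x"
    and weight_nonneg: "\<And>x y. x \<in> V \<Longrightarrow> y \<in> V \<Longrightarrow> 0 \<le> \<mu> x y"
    and weight_pos_iff: "\<And>x y. x \<in> V \<Longrightarrow> y \<in> V \<Longrightarrow> 0 < \<mu> x y \<longleftrightarrow> (x, y) \<in> E"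
    and locally_finite: "\<And>x. x \<in> V \<Longrightarrow> finite {y \<in> V. (x, y) \<in> E}"
    and connected: "\<And>x y. x \<in> V \<Longrightarrow> y \<in> V \<Longrightarrow> (x, y) \<in> E\<^sup>*"
    and infinite_vertices: "infinite V"

text \<open>
  The sum of \<open>\<mu> x y\<close> over all \<open>y \<in> V\<close> is taken over the neighbours of \<open>x\<close>, where
  alone the weight is nonzero; \<^const>\<open>sum\<close> over the infinite set \<open>V\<close> would be \<open>0\<close>.
\<close>

definition vertex_weight :: "'a set \<Rightarrow> ('a \<times> 'a) set \<Rightarrow> ('a \<Rightarrow> 'a \<Rightarrow> real) \<Rightarrow> 'a \<Rightarrow> real" where
  "vertex_weight V E \<mu> x = (\<Sum>y\<in>{y \<in> V. (x, y) \<in> E}. \<mu> x y)"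

definition vol :: "'a set \<Rightarrow> ('a \<times> 'a) set \<Rightarrow> ('a \<Rightarrow> 'a \<Rightarrow> real) \<Rightarrow> 'a set \<Rightarrow> real" where
  "vol V E \<mu> U = (\<Sum>x\<in>U. vertex_weight V E \<mu> x)"

definition edge_weight :: "('a \<Rightarrow> 'a \<Rightarrow> real) \<Rightarrow> 'a set \<Rightarrow> 'a set \<Rightarrow> real" where
  "edge_weight \<mu> V1 V2 = (\<Sum>x\<in>V1. \<Sum>y\<in>V2. \<mu> x y)"

definition graph_dist :: "('a \<times> 'a) set \<Rightarrow> 'a \<Rightarrow> 'a \<Rightarrow> nat" where
  "graph_dist E x y = (LEAST n. (x, y) \<in> E ^^ n)"

definition graph_ball :: "'a set \<Rightarrow> ('a \<times> 'a) set \<Rightarrow> 'a \<Rightarrow> nat \<Rightarrow> 'a set" where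
  "graph_ball V E x0 r = {y \<in> V. graph_dist E y x0 \<le> r}"

definition graph_sphere :: "'a set \<Rightarrow> ('a \<times> 'a) set \<Rightarrow> 'a \<Rightarrow> nat \<Rightarrow> 'a set" where
  "graph_sphere V E x0 r = {y \<in> V. graph_dist E y x0 = r}"

text \<open>
  As a double sum over ordered pairs, \<open>sphere_edge_weight\<close> counts every edge between
  distinct vertices of the sphere twice and every self-loop once.
\<close>

definition sphere_edge_weight ::
    "'a set \<Rightarrow> ('a \<times> 'a) set \<Rightarrow> ('a \<Rightarrow> 'a \<Rightarrow> real) \<Rightarrow> 'a \<Rightarrow> nat \<Rightarrow> real" where
  "sphere_edge_weight V E \<mu> x0 r =
     edge_weight \<mu> (graph_sphere V E x0 r) (graph_sphere V E x0 r)"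

definition total_sphere_edge_weight ::
    "'a set \<Rightarrow> ('a \<times> 'a) set \<Rightarrow> ('a \<Rightarrow> 'a \<Rightarrow> real) \<Rightarrow> 'a \<Rightarrow> nat \<Rightarrow> real" where
  "total_sphere_edge_weight V E \<mu> x0 r = (\<Sum>i=0..r. sphere_edge_weight V E \<mu> x0 i)"

text \<open>
  In an infinite weighted graph the set below is nonempty and bounded above by \<open>1\<close>,
  so the real-valued \<^const>\<open>Sup\<close> is the actual supremum.
\<close>

definition dual_cheeger :: "'a set \<Rightarrow> ('a \<times> 'a) set \<Rightarrow> ('a \<Rightarrow> 'a \<Rightarrow> real) \<Rightarrow> real" where
  "dual_cheeger V E \<mu> =
     Sup {2 * edge_weight \<mu> V1 V2 / (vol V E \<mu> V1 + vol V E \<mu> V2) | V1 V2.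
            V1 \<subseteq> V \<and> V2 \<subseteq> V \<and> finite V1 \<and> finite V2 \<and> V1 \<noteq> {} \<and> V2 \<noteq> {} \<and> V1 \<inter> V2 = {}}"

end

theory Submission imports Defs begin

text \<open>
  A ball \<open>B\<^sub>r\<close> splits into the vertices at even and at odd distance from \<open>x\<^sub>0\<close>. Distances of
  adjacent vertices differ by at most one, so an edge inside one of the two classes stays inside
  a single sphere: this split of \<open>B\<^sub>r\<close> is bipartite up to the edges counted by \<open>Q\<^sub>r\<close>.
  Of the total weight \<open>vol B\<^sub>r\<close>, the dual Cheeger bound leaves at most
  \<open>(1 - \<epsilon>\<^sub>0) vol B\<^sub>r\<close> to the edges between the two classes (lemma \<open>cut_le_dual_cheeger_times_vol\<close>).
  What remains after removing \<open>Q\<^sub>r\<close> too must leave the ball and therefore land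
  in \<open>S\<^sub>r\<^sub>+\<^sub>1\<close>, which gives \<open>vol B\<^sub>r\<^sub>+\<^sub>1 - vol B\<^sub>r \<ge> \<epsilon>\<^sub>0 vol B\<^sub>r - Q\<^sub>r\<close>
  (lemma \<open>vol_ball_growth\<close>). If \<open>Q\<^sub>r \<le> \<delta> vol B\<^sub>r\<close> for some \<open>\<delta> < \<epsilon>\<^sub>0\<close> and all large \<open>r\<close>,
  each further step multiplies the volume by at least \<open>1 + (\<epsilon>\<^sub>0 - \<delta>)\<close>.
\<close>

section \<open>Weights and volumes of finite vertex sets\<close>

lemma edge_weight_swap:
  assumes "\<And>x y. x \<in> A \<Longrightarrow> y \<in> B \<Longrightarrow> \<mu> x y = \<mu> y x"
  shows "edge_weight \<mu> A B = edge_weight \<mu> B A"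
  unfolding edge_weight_def using assms by (subst sum.swap) (intro sum.cong refl, simp)

lemma edge_weight_Un_left:
  "finite A \<Longrightarrow> finite B \<Longrightarrow> A \<inter> B = {} \<Longrightarrow>
    edge_weight \<mu> (A \<union> B) C = edge_weight \<mu> A C + edge_weight \<mu> B C"
  by (simp add: edge_weight_def sum.union_disjoint)

lemma edge_weight_Un_right:
  "finite A \<Longrightarrow> finite B \<Longrightarrow> A \<inter> B = {} \<Longrightarrow>
    edge_weight \<mu> C (A \<union> B) = edge_weight \<mu> C A + edge_weight \<mu> C B"
  by (simp add: edge_weight_def sum.union_disjoint sum.distrib)

lemma vol_Un_disjoint:
  "finite A \<Longrightarrow> finite B \<Longrightarrow> A \<inter> B = {} \<Longrightarrow> vol V E \<mu> (A \<union> B) = vol V E \<mu> A + vol V E \<mu> B"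
  by (simp add: vol_def sum.union_disjoint)

context infinite_weighted_graph
begin

lemma edge_sym: "(x, y) \<in> E \<Longrightarrow> (y, x) \<in> E"
  using edges_subset weight_pos_iff[of x y] weight_pos_iff[of y x] weight_sym[of x y] by auto

lemma weight_eq_0: "x \<in> V \<Longrightarrow> y \<in> V \<Longrightarrow> (x, y) \<notin> E \<Longrightarrow> \<mu> x y = 0"
  using weight_pos_iff[of x y] weight_nonneg[of x y] by force

lemma sum_weight_eq_neighbours:
  assumes "x \<in> V" "finite U" "U \<subseteq> V"
  shows "(\<Sum>y\<in>U. \<mu> x y) = (\<Sum>y\<in>{y \<in> U. (x, y) \<in> E}. \<mu> x y)"
  by (rule sum.mono_neutral_right) (use assms weight_eq_0 in auto)

lemma sum_weight_le_vertex_weight: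
  assumes "x \<in> V" "finite U" "U \<subseteq> V"
  shows "(\<Sum>y\<in>U. \<mu> x y) \<le> vertex_weight V E \<mu> x"
  unfolding sum_weight_eq_neighbours[OF assms] vertex_weight_def
  by (rule sum_mono2) (use assms locally_finite weight_nonneg in auto)

lemma sum_weight_eq_vertex_weight:
  assumes "x \<in> V" "finite U" "U \<subseteq> V" "\<And>y. (x, y) \<in> E \<Longrightarrow> y \<in> U"
  shows "(\<Sum>y\<in>U. \<mu> x y) = vertex_weight V E \<mu> x"
proof -
  have "{y \<in> U. (x, y) \<in> E} = {y \<in> V. (x, y) \<in> E}"
    using assms by auto
  thus ?thesis
    using sum_weight_eq_neighbours[OF assms(1-3)] by (simp add: vertex_weight_def)
qed

lemma edge_weight_le_vol:
  assumes "A \<subseteq> V" "B \<subseteq> V" "finite B"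
  shows "edge_weight \<mu> A B \<le> vol V E \<mu> A"
  unfolding edge_weight_def vol_def
  by (rule sum_mono) (use assms sum_weight_le_vertex_weight in auto)

lemma edge_weight_sym:
  assumes "A \<subseteq> V" "B \<subseteq> V"
  shows "edge_weight \<mu> A B = edge_weight \<mu> B A"
  by (rule edge_weight_swap) (use assms weight_sym in auto)

lemma vertex_weight_nonneg: "x \<in> V \<Longrightarrow> 0 \<le> vertex_weight V E \<mu> x"
  unfolding vertex_weight_def by (rule sum_nonneg) (use weight_nonneg in auto)

lemma vol_nonneg: "U \<subseteq> V \<Longrightarrow> 0 \<le> vol V E \<mu> U"
  unfolding vol_def by (rule sum_nonneg) (use vertex_weight_nonneg in auto)

lemma exists_other_neighbour:
  assumes "x \<in> V"
  obtains y where "y \<in> V" "(x, y) \<in> E" "y \<noteq> x"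
proof -
  have "\<exists>y. (x, y) \<in> E \<and> y \<noteq> x"
  proof (rule ccontr)
    assume stuck: "\<not> ?thesis"
    have "z = x" if "(x, z) \<in> E\<^sup>*" for z
      using that by (induction) (use stuck in auto)
    hence "V \<subseteq> {x}"
      using connected[OF assms] by auto
    thus False
      using infinite_vertices finite_subset by blast
  qed
  thus ?thesis
    using that edges_subset by blast
qed

lemma vertex_weight_pos:
  assumes "x \<in> V"
  shows "0 < vertex_weight V E \<mu> x"
proof -
  obtain y where y: "y \<in> V" "(x, y) \<in> E"
    using exists_other_neighbour[OF assms] by blast
  have "0 < \<mu> x y"
    using y assms weight_pos_iff by blast
  also have "\<mu> x y \<le> vertex_weight V E \<mu> x"
    using sum_weight_le_vertex_weight[of x "{y}"] y assms by simp
  finally show ?thesis .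
qed

text \<open>
  A supremum in the reals bounds a set from above only if the set has an upper bound.
  Here this is \<open>1\<close>, because the edges between \<open>A\<close> and \<open>B\<close> weigh at most \<open>vol A\<close> and at most
  \<open>vol B\<close>.
\<close>

lemma cut_le_dual_cheeger_times_vol:
  assumes A: "A \<subseteq> V" "finite A" "A \<noteq> {}" and B: "B \<subseteq> V" "finite B" "B \<noteq> {}"
    and disj: "A \<inter> B = {}"
  shows "2 * edge_weight \<mu> A B \<le> dual_cheeger V E \<mu> * (vol V E \<mu> A + vol V E \<mu> B)"
proof -
  let ?R = "{2 * edge_weight \<mu> V1 V2 / (vol V E \<mu> V1 + vol V E \<mu> V2) | V1 V2.
            V1 \<subseteq> V \<and> V2 \<subseteq> V \<and> finite V1 \<and> finite V2 \<and> V1 \<noteq> {} \<and> V2 \<noteq> {} \<and> V1 \<inter> V2 = {}}"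
  have pos: "0 < vol V E \<mu> U" if "U \<subseteq> V" "finite U" "U \<noteq> {}" for U
    unfolding vol_def by (rule sum_pos) (use that vertex_weight_pos in auto)
  have "2 * edge_weight \<mu> V1 V2 / (vol V E \<mu> V1 + vol V E \<mu> V2) \<le> 1"
    if "V1 \<subseteq> V" "V2 \<subseteq> V" "finite V1" "finite V2" "V1 \<noteq> {}" "V2 \<noteq> {}" for V1 V2
    using edge_weight_le_vol[of V1 V2] edge_weight_le_vol[of V2 V1] edge_weight_sym[of V1 V2]
      pos[of V1] pos[of V2] that by (simp add: divide_le_eq)
  hence "bdd_above ?R"
    by (intro bdd_aboveI[where M = 1]) blast
  hence "2 * edge_weight \<mu> A B / (vol V E \<mu> A + vol V E \<mu> B) \<le> dual_cheeger V E \<mu>"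
    unfolding dual_cheeger_def by (rule cSup_upper[rotated]) (use A B disj in blast)
  thus ?thesis
    using pos[of A] pos[of B] A B by (simp add: divide_le_eq)
qed

section \<open>Distances, spheres and balls\<close>

lemma graph_dist_relpow:
  assumes "x \<in> V" "y \<in> V"
  shows "(x, y) \<in> E ^^ graph_dist E x y"
  unfolding graph_dist_def
  using rtrancl_imp_relpow[OF connected[OF assms]] by (auto intro: LeastI)

lemma graph_dist_le: "(x, y) \<in> E ^^ n \<Longrightarrow> graph_dist E x y \<le> n"
  unfolding graph_dist_def by (rule Least_le)

lemma graph_dist_eq_0_iff:
  assumes "x \<in> V" "y \<in> V"
  shows "graph_dist E x y = 0 \<longleftrightarrow> x = y"
  using graph_dist_relpow[OF assms] graph_dist_le[of x y 0] by auto

lemma graph_dist_edge: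
  assumes "(x, y) \<in> E" "z \<in> V"
  shows "graph_dist E x z \<le> Suc (graph_dist E y z)"
proof -
  have "(y, z) \<in> E ^^ graph_dist E y z"
    using assms edges_subset by (intro graph_dist_relpow) auto
  thus ?thesis
    using assms(1) by (intro graph_dist_le relpow_Suc_I2)
qed

lemma ball_subset: "graph_ball V E x0 r \<subseteq> V"
  by (auto simp: graph_ball_def)

lemma sphere_subset: "graph_sphere V E x0 r \<subseteq> V"
  by (auto simp: graph_sphere_def)

lemma ball_Suc: "graph_ball V E x0 (Suc r) = graph_ball V E x0 r \<union> graph_sphere V E x0 (Suc r)"
  by (auto simp: graph_ball_def graph_sphere_def)

lemma ball_sphere_disjoint: "graph_ball V E x0 r \<inter> graph_sphere V E x0 (Suc r) = {}"
  by (auto simp: graph_ball_def graph_sphere_def)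

lemma neighbour_in_ball_Suc:
  assumes "x0 \<in> V" "x \<in> graph_ball V E x0 r" "(x, y) \<in> E"
  shows "y \<in> graph_ball V E x0 (Suc r)"
  using graph_dist_edge[OF edge_sym[OF assms(3)] assms(1)] assms(2,3) edges_subset
  by (auto simp: graph_ball_def)

lemma finite_ball:
  assumes "x0 \<in> V"
  shows "finite (graph_ball V E x0 r)"
proof (induction r)
  case 0
  have "graph_ball V E x0 0 \<subseteq> {x0}"
    using graph_dist_eq_0_iff assms by (auto simp: graph_ball_def)
  thus ?case
    using finite_subset by blast
next
  case (Suc r)
  let ?N = "\<Union>z\<in>graph_ball V E x0 r. {y \<in> V. (z, y) \<in> E}"
  have "y \<in> ?N" if y: "y \<in> graph_sphere V E x0 (Suc r)" for y
  proof -
    have "(y, x0) \<in> E ^^ Suc r"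
      using y graph_dist_relpow[of y x0] assms by (auto simp: graph_sphere_def)
    then obtain z where "(y, z) \<in> E" "(z, x0) \<in> E ^^ r"
      by (rule relpow_Suc_E2)
    thus ?thesis
      using edge_sym[of y z] edges_subset graph_dist_le[of z x0 r] by (auto simp: graph_ball_def)
  qed
  hence "graph_ball V E x0 (Suc r) \<subseteq> graph_ball V E x0 r \<union> ?N"
    unfolding ball_Suc by blast
  moreover have "finite ?N"
    using Suc.IH locally_finite ball_subset by blast
  ultimately show ?case
    using Suc.IH finite_subset by blast
qed

lemma finite_sphere: "x0 \<in> V \<Longrightarrow> finite (graph_sphere V E x0 r)"
  by (rule finite_subset[OF _ finite_ball[of x0 r]]) (auto simp: graph_ball_def graph_sphere_def)

lemma vol_ball_pos:
  assumes "x0 \<in> V"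
  shows "0 < vol V E \<mu> (graph_ball V E x0 r)"
  unfolding vol_def
proof (rule sum_pos)
  show "graph_ball V E x0 r \<noteq> {}"
    using assms graph_dist_eq_0_iff[of x0 x0] by (auto simp: graph_ball_def)
qed (use finite_ball[OF assms] ball_subset[THEN subsetD] vertex_weight_pos in blast)+

lemma vol_ball_Suc:
  "x0 \<in> V \<Longrightarrow> vol V E \<mu> (graph_ball V E x0 (Suc r))
    = vol V E \<mu> (graph_ball V E x0 r) + vol V E \<mu> (graph_sphere V E x0 (Suc r))"
  unfolding ball_Suc
  using vol_Un_disjoint[OF finite_ball finite_sphere ball_sphere_disjoint] .

text \<open>
  Every neighbour of a vertex of \<open>B\<^sub>r\<close> lies in \<open>B\<^sub>r\<close> or \<open>S\<^sub>r\<^sub>+\<^sub>1\<close>, and the edges into the sphere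
  weigh no more than the sphere itself.
\<close>

lemma vol_ball_le:
  assumes "x0 \<in> V"
  shows "vol V E \<mu> (graph_ball V E x0 r) \<le>
    edge_weight \<mu> (graph_ball V E x0 r) (graph_ball V E x0 r)
    + vol V E \<mu> (graph_sphere V E x0 (Suc r))"
proof -
  let ?B = "graph_ball V E x0 r" and ?S = "graph_sphere V E x0 (Suc r)"
  have "vertex_weight V E \<mu> x = (\<Sum>y\<in>graph_ball V E x0 (Suc r). \<mu> x y)" if "x \<in> ?B" for x
    using sum_weight_eq_vertex_weight[OF _ finite_ball[OF assms] ball_subset
        neighbour_in_ball_Suc[OF assms that]] that ball_subset by (metis subsetD)
  hence "vol V E \<mu> ?B = edge_weight \<mu> ?B (?B \<union> ?S)"
    by (simp add: vol_def edge_weight_def ball_Suc)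
  also have "\<dots> = edge_weight \<mu> ?B ?B + edge_weight \<mu> ?S ?B"
    using edge_weight_Un_right[OF finite_ball finite_sphere ball_sphere_disjoint] assms
      edge_weight_sym[OF ball_subset sphere_subset] by simp
  also have "edge_weight \<mu> ?S ?B \<le> vol V E \<mu> ?S"
    by (rule edge_weight_le_vol) (use sphere_subset ball_subset finite_ball assms in auto)
  finally show ?thesis by simp
qed

section \<open>The parity cut of a ball\<close>

lemma total_sphere_edge_weight_eq:
  assumes "x0 \<in> V"
  shows "total_sphere_edge_weight V E \<mu> x0 r =
    (\<Sum>x\<in>graph_ball V E x0 r. \<Sum>y\<in>graph_sphere V E x0 (graph_dist E x x0). \<mu> x y)"
proof (induction r)
  case 0
  have "graph_ball V E x0 0 = graph_sphere V E x0 0"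
    by (auto simp: graph_ball_def graph_sphere_def)
  thus ?case
    by (simp add: total_sphere_edge_weight_def sphere_edge_weight_def edge_weight_def
        graph_sphere_def)
next
  case (Suc r)
  have "(\<Sum>x\<in>graph_sphere V E x0 (Suc r). \<Sum>y\<in>graph_sphere V E x0 (graph_dist E x x0). \<mu> x y)
      = sphere_edge_weight V E \<mu> x0 (Suc r)"
    by (simp add: sphere_edge_weight_def edge_weight_def graph_sphere_def)
  thus ?case
    using Suc.IH unfolding ball_Suc
    by (subst sum.union_disjoint[OF finite_ball finite_sphere ball_sphere_disjoint])
      (simp_all add: assms total_sphere_edge_weight_def)
qed

text \<open>
  Adjacent vertices whose distances to \<open>x\<^sub>0\<close> have the same parity are at equal distance, since
  the distances differ by at most one.
\<close>

lemma sum_weight_same_parity: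
  assumes "x0 \<in> V" "x \<in> graph_ball V E x0 r"
  shows "(\<Sum>y\<in>{y \<in> graph_ball V E x0 r. even (graph_dist E y x0) = even (graph_dist E x x0)}. \<mu> x y)
    = (\<Sum>y\<in>graph_sphere V E x0 (graph_dist E x x0). \<mu> x y)"
proof (rule sum.mono_neutral_right)
  show "\<forall>y\<in>{y \<in> graph_ball V E x0 r. even (graph_dist E y x0) = even (graph_dist E x x0)}
      - graph_sphere V E x0 (graph_dist E x x0). \<mu> x y = 0"
  proof
    fix y
    assume y: "y \<in> {y \<in> graph_ball V E x0 r. even (graph_dist E y x0) = even (graph_dist E x x0)}
      - graph_sphere V E x0 (graph_dist E x x0)"
    hence ne: "graph_dist E y x0 \<noteq> graph_dist E x x0"
      and par: "even (graph_dist E y x0) = even (graph_dist E x x0)"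
      by (auto simp: graph_ball_def graph_sphere_def)
    have "(x, y) \<notin> E"
    proof
      assume e: "(x, y) \<in> E"
      have "graph_dist E x x0 = Suc (graph_dist E y x0) \<or> graph_dist E y x0 = Suc (graph_dist E x x0)"
        using graph_dist_edge[OF e assms(1)] graph_dist_edge[OF edge_sym[OF e] assms(1)] ne
        by linarith
      thus False
        using par by auto
    qed
    thus "\<mu> x y = 0"
      using y assms ball_subset weight_eq_0 by blast
  qed
  show "finite {y \<in> graph_ball V E x0 r. even (graph_dist E y x0) = even (graph_dist E x x0)}"
    using finite_ball[OF assms(1)] by simp
qed (use assms in \<open>auto simp: graph_ball_def graph_sphere_def\<close>)

text \<open>
  The only edges that the parity cut of a ball misses are those inside the spheres; every other
  edge is met twice by ordered pairs.
\<close>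

lemma edge_weight_ball:
  assumes "x0 \<in> V"
  defines "A r \<equiv> {x \<in> graph_ball V E x0 r. even (graph_dist E x x0)}"
    and "B r \<equiv> {x \<in> graph_ball V E x0 r. odd (graph_dist E x x0)}"
  shows "edge_weight \<mu> (graph_ball V E x0 r) (graph_ball V E x0 r)
    = total_sphere_edge_weight V E \<mu> x0 r + 2 * edge_weight \<mu> (A r) (B r)"
proof -
  let ?g = "\<lambda>x. \<Sum>y\<in>graph_sphere V E x0 (graph_dist E x x0). \<mu> x y"
  have AB: "graph_ball V E x0 r = A r \<union> B r" "A r \<inter> B r = {}"
    by (auto simp: A_def B_def)
  have fin: "finite (A r)" "finite (B r)"
    using finite_ball[OF assms(1)] by (auto simp: A_def B_def)
  have sub: "A r \<subseteq> V" "B r \<subseteq> V"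
    using ball_subset by (auto simp: A_def B_def)
  have "edge_weight \<mu> (A r) (A r) = sum ?g (A r)"
    unfolding edge_weight_def
  proof (rule sum.cong[OF refl])
    fix x assume "x \<in> A r"
    thus "(\<Sum>y\<in>A r. \<mu> x y) = ?g x"
      using sum_weight_same_parity[OF assms(1), of x r] by (simp add: A_def)
  qed
  moreover have "edge_weight \<mu> (B r) (B r) = sum ?g (B r)"
    unfolding edge_weight_def
  proof (rule sum.cong[OF refl])
    fix x assume "x \<in> B r"
    thus "(\<Sum>y\<in>B r. \<mu> x y) = ?g x"
      using sum_weight_same_parity[OF assms(1), of x r] by (simp add: B_def)
  qed
  ultimately have "edge_weight \<mu> (A r) (A r) + edge_weight \<mu> (B r) (B r)
      = total_sphere_edge_weight V E \<mu> x0 r"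
    unfolding total_sphere_edge_weight_eq[OF assms(1)] AB(1)
    by (simp add: sum.union_disjoint[OF fin AB(2)])
  thus ?thesis
    unfolding AB(1) using edge_weight_sym[OF sub]
    by (simp add: edge_weight_Un_left[OF fin AB(2)] edge_weight_Un_right[OF fin AB(2)])
qed

lemma vol_ball_growth:
  assumes "x0 \<in> V" "1 \<le> r"
  shows "(2 - dual_cheeger V E \<mu>) * vol V E \<mu> (graph_ball V E x0 r)
      - total_sphere_edge_weight V E \<mu> x0 r
    \<le> vol V E \<mu> (graph_ball V E x0 (Suc r))"
proof -
  let ?B = "graph_ball V E x0 r"
  define V1 where "V1 = {x \<in> ?B. even (graph_dist E x x0)}"
  define V2 where "V2 = {x \<in> ?B. odd (graph_dist E x x0)}"
  have fin: "finite V1" "finite V2"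
    using finite_ball[OF assms(1)] by (auto simp: V1_def V2_def)
  have disj: "V1 \<inter> V2 = {}" and Un: "V1 \<union> V2 = ?B"
    by (auto simp: V1_def V2_def)
  have "x0 \<in> V1"
    using assms graph_dist_eq_0_iff[of x0 x0] by (simp add: V1_def graph_ball_def)
  moreover have "V2 \<noteq> {}"
  proof -
    obtain y where y: "y \<in> V" "(x0, y) \<in> E" "y \<noteq> x0"
      using exists_other_neighbour[OF assms(1)] by blast
    have "graph_dist E y x0 = 1"
      using graph_dist_edge[OF edge_sym[OF y(2)] assms(1)] graph_dist_eq_0_iff[of y x0]
        graph_dist_eq_0_iff[of x0 x0] y assms(1) by auto
    hence "y \<in> V2"
      using y assms(2) by (simp add: V2_def graph_ball_def)
    thus ?thesis by blast
  qed
  ultimately have "2 * edge_weight \<mu> V1 V2 \<le> dual_cheeger V E \<mu> * (vol V E \<mu> V1 + vol V E \<mu> V2)"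
    using fin disj ball_subset by (intro cut_le_dual_cheeger_times_vol) (auto simp: V1_def V2_def)
  hence cut: "2 * edge_weight \<mu> V1 V2 \<le> dual_cheeger V E \<mu> * vol V E \<mu> ?B"
    using vol_Un_disjoint[OF fin disj] Un by metis
  have "edge_weight \<mu> ?B ?B = total_sphere_edge_weight V E \<mu> x0 r + 2 * edge_weight \<mu> V1 V2"
    unfolding V1_def V2_def by (rule edge_weight_ball[OF assms(1)])
  thus ?thesis
    using cut vol_ball_le[OF assms(1), of r] vol_ball_Suc[OF assms(1), of r]
    by (simp add: algebra_simps)
qed

end

section \<open>Exponential growth\<close>

text \<open>
  Before the step \<open>R\<close> from which growth by the factor \<open>1 + c\<close> is known, monotonicity is enough:
  the loss over these finitely many steps is absorbed by \<open>C\<^sub>1 = f(0) / (1 + c)\<^sup>R\<close>.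
\<close>

lemma exponential_lower_bound:
  fixes f :: "nat \<Rightarrow> real"
  assumes pos: "0 < f 0" and mono: "\<And>r. f r \<le> f (Suc r)"
    and c: "0 < c" and step: "\<And>r. R \<le> r \<Longrightarrow> (1 + c) * f r \<le> f (Suc r)"
  shows "\<exists>C1 C2. 0 < C1 \<and> 0 < C2 \<and> (\<forall>r. C1 * exp (C2 * real r) \<le> f r)"
proof -
  have "f 0 \<le> f r" for r
    using lift_Suc_mono_le[of f 0 r] mono by simp
  have bound: "f 0 * (1 + c) ^ r \<le> f r * (1 + c) ^ R" for r
  proof (cases "r \<le> R")
    case True
    thus ?thesis
      using \<open>f 0 \<le> f r\<close> pos c by (intro mult_mono power_increasing) auto
  next
    case False
    hence "R \<le> r" by simp
    thus ?thesis
    proof (induction r rule: dec_induct)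
      case base
      show ?case
        using \<open>f 0 \<le> f R\<close> c by (intro mult_right_mono) auto
    next
      case (step n)
      have "f 0 * (1 + c) ^ Suc n \<le> (1 + c) * f n * (1 + c) ^ R"
        using mult_left_mono[OF step.IH, of "1 + c"] c by (simp add: mult_ac)
      also have "\<dots> \<le> f (Suc n) * (1 + c) ^ R"
        using assms(4)[OF step.hyps(1)] c by (intro mult_right_mono) auto
      finally show ?case .
    qed
  qed
  have "exp (ln (1 + c) * real r) = (1 + c) ^ r" for r
    using c by (simp add: exp_of_nat2_mult)
  hence "f 0 / (1 + c) ^ R * exp (ln (1 + c) * real r) \<le> f r" for r
    using bound[of r] c by (simp add: divide_le_eq)
  moreover have "0 < f 0 / (1 + c) ^ R" "0 < ln (1 + c)"
    using pos c by simp_all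
  ultimately show ?thesis by blast
qed

theorem theorem8p1:
  fixes V :: "'a set" and E :: "('a \<times> 'a) set" and \<mu> :: "'a \<Rightarrow> 'a \<Rightarrow> real"
    and x0 :: 'a and \<epsilon>0 :: real
  assumes "infinite_weighted_graph V E \<mu>"
    and "0 < \<epsilon>0" and "\<epsilon>0 < 1"
    and "dual_cheeger V E \<mu> \<le> 1 - \<epsilon>0"
    and "x0 \<in> V"
    and "limsup (\<lambda>r. ereal (total_sphere_edge_weight V E \<mu> x0 r / vol V E \<mu> (graph_ball V E x0 r)))
           < ereal \<epsilon>0"
  shows "\<exists>C1 C2 :: real. C1 > 0 \<and> C2 > 0 \<and>
           (\<forall>r::nat. r \<ge> 1 \<longrightarrow> vol V E \<mu> (graph_ball V E x0 r) \<ge> C1 * exp (C2 * real r))"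
proof -
  interpret infinite_weighted_graph V E \<mu> by fact
  define f where "f r = vol V E \<mu> (graph_ball V E x0 r)" for r
  define Q where "Q = total_sphere_edge_weight V E \<mu> x0"
  have f_pos: "0 < f r" for r
    unfolding f_def using vol_ball_pos[OF assms(5)] .
  (* A strict bound on the limsup leaves room for a uniform gap between \<delta> and \<epsilon>0. *)
  obtain \<delta> where \<delta>: "limsup (\<lambda>r. ereal (Q r / f r)) < ereal \<delta>" "\<delta> < \<epsilon>0"
    using ereal_dense2[OF assms(6)] unfolding Q_def f_def by auto
  obtain N where N: "\<And>r. N \<le> r \<Longrightarrow> Q r / f r < \<delta>"
    using Limsup_lessD[OF \<delta>(1)] by (auto simp: eventually_sequentially)
  have "\<exists>C1 C2. 0 < C1 \<and> 0 < C2 \<and> (\<forall>r. C1 * exp (C2 * real r) \<le> f r)"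
  proof (rule exponential_lower_bound)
    show "f r \<le> f (Suc r)" for r
      unfolding f_def vol_ball_Suc[OF assms(5)] using vol_nonneg[OF sphere_subset] by simp
    (* Radius 0 is excluded since there the odd side of the parity cut is empty. *)
    show "(1 + (\<epsilon>0 - \<delta>)) * f r \<le> f (Suc r)" if "max N 1 \<le> r" for r
    proof -
      have "Q r \<le> \<delta> * f r"
        using N[of r] f_pos[of r] that by (simp add: divide_less_eq)
      moreover have "(1 + \<epsilon>0) * f r \<le> (2 - dual_cheeger V E \<mu>) * f r"
        using assms(4) f_pos[of r] by (intro mult_right_mono) auto
      moreover have "(2 - dual_cheeger V E \<mu>) * f r - Q r \<le> f (Suc r)"
        unfolding f_def Q_def using vol_ball_growth[OF assms(5)] that by simp
      ultimately show ?thesis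
        by (simp add: algebra_simps)
    qed
  qed (use f_pos \<delta> in auto)
  thus ?thesis
    unfolding f_def by blast
qed

end
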